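(* For every $n\in\{0,1,2,3,\ldots\}$, $$\frac{d}{d_qx}G_{n,q}^{(\alpha)}(x)=[n]_q\,G_{n-1,q}^{(\alpha)}(x),$$ where for $n=0$ the right-hand side is read as $0$ (since $[0]_q=0$).
   Context: Fix $q\in\mathbb{C}$ with $|q|<1$ and a positive integer $\alpha$. Put $[x]_q=\frac{1-q^x}{1-q}$ and $[n]_q!=[n]_q[n-1]_q\cdots[1]_q$ (with $[0]_q!=1$). The $q$-exponential is $e_q(z)=\sum_{l=0}^\infty \frac{z^l}{[l]_q!}$. The $q$-derivative is $\frac{d}{d_qx}f(x)=\frac{f(x)-f(qx)}{(1-q)x}$ (for $x\neq 0$; for a polynomial $f$ the result is again a polynomial in $x$). The $q$-Genocchi polynomials of order $\alpha$, $G_{n,q}^{(\alpha)}(x)$, are defined by the generating function (power series in $z$) $$\sum_{n=0}^{\infty}\frac{z^n}{[n]_q!}G_{n,q}^{(\alpha)}(x)=\left(\frac{[2]_q z}{e_q(z)+1}\right)^{\alpha}e_q(zx).$$ *)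

theory Defs
  imports Complex_Main "HOL-Computational_Algebra.Formal_Power_Series"
begin

definition qnum :: "complex \<Rightarrow> nat \<Rightarrow> complex" where
  "qnum q n = (1 - q ^ n) / (1 - q)"

definition qfact :: "complex \<Rightarrow> nat \<Rightarrow> complex" where
  "qfact q n = (\<Prod>k=1..n. qnum q k)"

definition qexp :: "complex \<Rightarrow> complex fps" where
  "qexp q = Abs_fps (\<lambda>l. 1 / qfact q l)"

text \<open>The defining quotient makes no sense at \<open>x = 0\<close>; there we take its limit.  For a
  polynomial \<open>f\<close> the quotient agrees with a polynomial away from \<open>0\<close>, and the limit is the value
  of that polynomial at \<open>0\<close>.\<close>

definition qderiv :: "complex \<Rightarrow> (complex \<Rightarrow> complex) \<Rightarrow> complex \<Rightarrow> complex" where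
  "qderiv q f x =
     (if x = 0 then Lim (at 0) (\<lambda>t. (f t - f (q * t)) / ((1 - q) * t))
      else (f x - f (q * x)) / ((1 - q) * x))"

definition qGenocchi_gf :: "complex \<Rightarrow> nat \<Rightarrow> complex \<Rightarrow> complex fps" where
  "qGenocchi_gf q \<alpha> x =
     (fps_const (qnum q 2) * fps_X / (qexp q + 1)) ^ \<alpha> * (qexp q oo (fps_const x * fps_X))"

definition qGenocchi :: "complex \<Rightarrow> nat \<Rightarrow> nat \<Rightarrow> complex \<Rightarrow> complex" where
  "qGenocchi q \<alpha> n x = qfact q n * fps_nth (qGenocchi_gf q \<alpha> x) n"

lemma qnum_nonzero:
  assumes "norm q < 1" "n > 0"
  shows "qnum q n \<noteq> 0"
proof -
  have "norm (q ^ n) < 1"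
    using assms by (simp add: norm_power power_less_one_iff)
  then have "q ^ n \<noteq> 1" by auto
  moreover have "q \<noteq> 1" using assms by auto
  ultimately show ?thesis by (simp add: qnum_def)
qed

lemma qfact_nonzero: "norm q < 1 \<Longrightarrow> qfact q n \<noteq> 0"
  by (auto simp: qfact_def qnum_nonzero)

text \<open>The generating function identity characterises the polynomials.\<close>

lemma qGenocchi_generating_function:
  assumes "norm q < 1"
  shows "Abs_fps (\<lambda>n. g n / qfact q n) = qGenocchi_gf q \<alpha> x
           \<longleftrightarrow> (\<forall>n. g n = qGenocchi q \<alpha> n x)"
  using qfact_nonzero[OF assms]
  by (auto simp: fps_eq_iff qGenocchi_def field_simps)

end

theory Submission
  imports Defs
begin

text \<open>The variable \<open>x\<close> enters the generating function only through the factor \<open>e\<^sub>q(zx)\<close>, so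
  the polynomial of index \<open>n\<close> is the Appell-type sum
  \<open>G\<^sub>n(x) = [n]! \<Sum>\<^sub>k a\<^sub>n\<^sub>-\<^sub>k x\<^sup>k / [k]!\<close>, where the \<open>a\<^sub>j\<close> are the coefficients of the prefactor and
  do not depend on \<open>x\<close>.  The \<open>q\<close>-derivative sends \<open>x\<^sup>k / [k]!\<close> to \<open>x\<^sup>k\<^sup>-\<^sup>1 / [k-1]!\<close>; the sum
  therefore turns into the one for index \<open>n - 1\<close>, the leading \<open>[n]! = [n] [n-1]!\<close> supplying
  the factor \<open>[n]\<close>.\<close>

lemma qfact_Suc: "qfact q (Suc n) = qfact q n * qnum q (Suc n)"
  by (simp add: qfact_def)

lemma qGenocchi_expansion:
  "qGenocchi q \<alpha> n x =
     (\<Sum>k\<le>n. qfact q n * fps_nth ((fps_const (qnum q 2) * fps_X / (qexp q + 1)) ^ \<alpha>) (n - k)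
              / qfact q k * x ^ k)"
proof -
  define A where "A = (fps_const (qnum q 2) * fps_X / (qexp q + 1)) ^ \<alpha>"
  have "fps_nth (qGenocchi_gf q \<alpha> x) n
      = fps_nth (Abs_fps (\<lambda>n. x ^ n * fps_nth (qexp q) n) * A) n"
    unfolding qGenocchi_gf_def A_def[symmetric] by (simp only: fps_compose_linear mult.commute[of A])
  also have "\<dots> = (\<Sum>k\<le>n. x ^ k * (1 / qfact q k) * fps_nth A (n - k))"
    by (simp add: fps_mult_nth qexp_def atLeast0AtMost)
  finally show ?thesis
    unfolding A_def[symmetric] by (simp add: qGenocchi_def sum_distrib_left mult_ac)
qed

text \<open>Away from the origin this is the termwise rule \<open>x\<^sup>k \<mapsto> [k] x\<^sup>k\<^sup>-\<^sup>1\<close>.  At the origin the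
  difference quotient agrees with the polynomial on the right in a punctured neighbourhood,
  so its limit is the value of that polynomial by continuity.\<close>

lemma qderiv_polynomial:
  assumes "q \<noteq> 1"
  shows "qderiv q (\<lambda>t. \<Sum>k\<le>n. c k * t ^ k) x = (\<Sum>k<n. c (Suc k) * qnum q (Suc k) * x ^ k)"
proof -
  define f where "f = (\<lambda>t. \<Sum>k\<le>n. c k * t ^ k)"
  define p where "p = (\<lambda>t. \<Sum>k<n. c (Suc k) * qnum q (Suc k) * t ^ k)"
  have quotient: "(f t - f (q * t)) / ((1 - q) * t) = p t" if "t \<noteq> 0" for t
  proof -
    have "f t - f (q * t) = (\<Sum>k\<le>n. c k * (t ^ k - (q * t) ^ k))"
      by (simp add: f_def sum_subtractf right_diff_distrib)
    \<comment> \<open>the constant term cancels, so a factor \<open>t\<close> can be split off\<close>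
    also have "\<dots> = (\<Sum>k<n. c (Suc k) * (t ^ Suc k - (q * t) ^ Suc k))"
      by (simp add: sum.atMost_shift)
    also have "\<dots> = (\<Sum>k<n. (c (Suc k) * qnum q (Suc k) * t ^ k) * ((1 - q) * t))"
      using assms
      by (intro sum.cong) (auto simp: qnum_def power_mult_distrib field_simps)
    also have "\<dots> = p t * ((1 - q) * t)"
      by (simp add: p_def sum_distrib_right)
    finally show ?thesis using that assms by simp
  qed
  have "(p \<longlongrightarrow> p 0) (at 0)"
    unfolding p_def by (intro tendsto_intros)
  then have "((\<lambda>t. (f t - f (q * t)) / ((1 - q) * t)) \<longlongrightarrow> p 0) (at 0)"
    by (rule Lim_transform_eventually) (auto simp: quotient eventually_at_filter)
  then have "Lim (at 0) (\<lambda>t. (f t - f (q * t)) / ((1 - q) * t)) = p 0"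
    by (intro tendsto_Lim) auto
  with quotient have "qderiv q f x = p x"
    by (simp add: qderiv_def)
  then show ?thesis by (simp add: f_def p_def)
qed

theorem theorem2p2:
  fixes q :: complex and \<alpha> n :: nat and x :: complex
  assumes "norm q < 1" and "\<alpha> > 0"
  shows "qderiv q (qGenocchi q \<alpha> n) x =
           (if n = 0 then 0 else qnum q n * qGenocchi q \<alpha> (n - 1) x)"
proof -
  define A where "A = (fps_const (qnum q 2) * fps_X / (qexp q + 1)) ^ \<alpha>"
  have expansion: "qGenocchi q \<alpha> m = (\<lambda>t. \<Sum>k\<le>m. qfact q m * fps_nth A (m - k) / qfact q k * t ^ k)"
    for m by (simp add: fun_eq_iff qGenocchi_expansion A_def)
  have "q \<noteq> 1" using assms(1) by auto
  then have deriv: "qderiv q (qGenocchi q \<alpha> n) x =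
      (\<Sum>k<n. qfact q n * fps_nth A (n - Suc k) / qfact q (Suc k) * qnum q (Suc k) * x ^ k)"
    unfolding expansion by (rule qderiv_polynomial)
  show ?thesis
  proof (cases n)
    case 0
    then show ?thesis using deriv by simp
  next
    case (Suc m)
    have "qderiv q (qGenocchi q \<alpha> n) x =
        (\<Sum>k\<le>m. qnum q n * (qfact q m * fps_nth A (m - k) / qfact q k * x ^ k))"
      unfolding deriv unfolding Suc lessThan_Suc_atMost
      by (intro sum.cong) (simp_all add: qfact_Suc qnum_nonzero[OF assms(1)])
    then show ?thesis
      using Suc by (simp add: expansion sum_distrib_left)
  qed
qed

end
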